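(* Let $G$ be a topological group and let $p\colon E\to B$ be a $G$-fibration. If $H$ and $K$ are subgroups of $G$ such that $E^H$ and $B^H$ are $K$-invariant, and the fixed point map $p^H\colon E^H\to B^H$ (the restriction of $p$) is a $K$-map, then $$\mathrm{secat}_K(p^H)\le\mathrm{secat}_G(p).$$ In particular, if $G$ is a compact Hausdorff topological group, then 1. the fixed point map $p^H\colon E^H\to B^H$ is a fibration for all closed subgroups $H$ of $G$, and $\mathrm{secat}(p^H)\le\mathrm{secat}_G(p)$; 2. $p\colon E\to B$ is a $K$-fibration for all closed subgroups $K$ of $G$, and $\mathrm{secat}(p)\le\mathrm{secat}_K(p)\le\mathrm{secat}_G(p)$.
   Context: All spaces are Hausdorff. A $G$-map is a continuous equivariant map; a $G$-homotopy is an equivariant homotopy ($G$ acting trivially on $[0,1]$). A $G$-fibration is a $G$-map with the $G$-homotopy lifting property with respect to every $G$-space. For a $G$-space $X$ and a subgroup $H\le G$, $X^H=\{x\in X: h\cdot x=x\text{ for all }h\in H\}$. Equivariant sectional category: for a $G$-map $p\colon E\to B$, $\mathrm{secat}_G(p)$ is the least positive integer $k$ such that $B$ has a cover by $G$-invariant open sets $U_1,\dots,U_k$ with $G$-maps $s_i\colon U_i\to E$ such that $p\circ s_i$ is $G$-homotopic to the inclusion $U_i\hookrightarrow B$ ($\infty$ if there is no such $k$). The sectional category $\mathrm{secat}$ is the same invariant for the trivial group. *)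

theory Defs
  imports
    "HOL-Analysis.Analysis"
    "HOL-Algebra.Group_Action"
    "HOL-Algebra.Elementary_Groups"
    "HOL-Library.Extended_Nat"
begin

locale topological_group = group G for G :: "('g, 'm) monoid_scheme" (structure) +
  fixes T :: "'g topology"
  assumes topspace_eq_carrier: "topspace T = carrier G"
    and continuous_mult: "continuous_map (prod_topology T T) T (\<lambda>(x, y). x \<otimes> y)"
    and continuous_inv: "continuous_map T T (\<lambda>x. inv x)"

record ('g, 'x) gspace =
  gtop :: "'x topology"
  gact :: "'g \<Rightarrow> 'x \<Rightarrow> 'x"

abbreviation pts :: "('g, 'x) gspace \<Rightarrow> 'x set" where
  "pts X \<equiv> topspace (gtop X)"

text \<open>
  Spaces are Hausdorff throughout, and this is part of the definition of a \<open>G\<close>-space.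
  Topological groups are not required to be Hausdorff.
  A subgroup \<open>K\<close> is used as the acting group by replacing \<open>G\<close> with \<open>G\<lparr>carrier := K\<rparr>\<close> and
  \<open>T\<close> with \<open>subtopology T K\<close>; the restriction of the action to \<open>K\<close> needs no change of the record,
  since only the values of \<open>gact\<close> on the carrier matter.
\<close>

definition G_space :: "('g, 'm) monoid_scheme \<Rightarrow> 'g topology \<Rightarrow> ('g, 'x) gspace \<Rightarrow> bool" where
  "G_space G T X \<longleftrightarrow>
     group_action G (pts X) (gact X) \<and>
     continuous_map (prod_topology T (gtop X)) (gtop X) (\<lambda>(g, x). gact X g x) \<and>
     Hausdorff_space (gtop X)"

definition G_invariant :: "('g, 'm) monoid_scheme \<Rightarrow> ('g, 'x) gspace \<Rightarrow> 'x set \<Rightarrow> bool" where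
  "G_invariant G X A \<longleftrightarrow> (\<forall>g\<in>carrier G. \<forall>x\<in>A. gact X g x \<in> A)"

text \<open>
  The action on a subspace is cut down with \<open>restrict\<close> because \<open>group_action\<close> asks the
  transformations to be extensional functions on the set acted upon.
\<close>

definition gsubspace :: "('g, 'x) gspace \<Rightarrow> 'x set \<Rightarrow> ('g, 'x) gspace" where
  "gsubspace X A = \<lparr>gtop = subtopology (gtop X) A, gact = (\<lambda>g. restrict (gact X g) A)\<rparr>"

definition fixed_points :: "('g, 'x) gspace \<Rightarrow> 'g set \<Rightarrow> 'x set" where
  "fixed_points X H = {x \<in> pts X. \<forall>h\<in>H. gact X h x = x}"

definition fixed_space :: "('g, 'x) gspace \<Rightarrow> 'g set \<Rightarrow> ('g, 'x) gspace" where
  "fixed_space X H = gsubspace X (fixed_points X H)"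

definition equivariant ::
  "('g, 'm) monoid_scheme \<Rightarrow> ('g, 'x) gspace \<Rightarrow> ('g, 'y) gspace \<Rightarrow> ('x \<Rightarrow> 'y) \<Rightarrow> bool" where
  "equivariant G X Y f \<longleftrightarrow> (\<forall>g\<in>carrier G. \<forall>x\<in>pts X. f (gact X g x) = gact Y g (f x))"

definition G_map ::
  "('g, 'm) monoid_scheme \<Rightarrow> ('g, 'x) gspace \<Rightarrow> ('g, 'y) gspace \<Rightarrow> ('x \<Rightarrow> 'y) \<Rightarrow> bool" where
  "G_map G X Y f \<longleftrightarrow> continuous_map (gtop X) (gtop Y) f \<and> equivariant G X Y f"

text \<open>
  Since \<open>G\<close> acts trivially on \<open>[0,1]\<close>, a homotopy is equivariant iff each of its stages is.
  The interval is the first factor, as in \<^const>\<open>homotopic_with\<close>.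
\<close>

definition G_homotopy ::
  "('g, 'm) monoid_scheme \<Rightarrow> ('g, 'x) gspace \<Rightarrow> ('g, 'y) gspace \<Rightarrow> (real \<times> 'x \<Rightarrow> 'y) \<Rightarrow> bool" where
  "G_homotopy G X Y h \<longleftrightarrow>
     continuous_map (prod_topology (top_of_set {0..1}) (gtop X)) (gtop Y) h \<and>
     (\<forall>t\<in>{0..1}. equivariant G X Y (\<lambda>x. h (t, x)))"

definition G_homotopic ::
  "('g, 'm) monoid_scheme \<Rightarrow> ('g, 'x) gspace \<Rightarrow> ('g, 'y) gspace \<Rightarrow> ('x \<Rightarrow> 'y) \<Rightarrow> ('x \<Rightarrow> 'y) \<Rightarrow> bool" where
  "G_homotopic G X Y = homotopic_with (equivariant G X Y) (gtop X) (gtop Y)"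

definition G_HLP ::
  "('g, 'm) monoid_scheme \<Rightarrow> ('g, 'x) gspace \<Rightarrow> ('g, 'e) gspace \<Rightarrow> ('g, 'b) gspace \<Rightarrow> ('e \<Rightarrow> 'b) \<Rightarrow> bool" where
  "G_HLP G X E B p \<longleftrightarrow>
     (\<forall>f F. G_map G X E f \<and> G_homotopy G X B F \<and> (\<forall>x\<in>pts X. F (0, x) = p (f x)) \<longrightarrow>
        (\<exists>F'. G_homotopy G X E F' \<and> (\<forall>x\<in>pts X. F' (0, x) = f x) \<and>
              (\<forall>t\<in>{0..1}. \<forall>x\<in>pts X. p (F' (t, x)) = F (t, x))))"

text \<open>
  A fibration has the homotopy lifting property with respect to every \<open>G\<close>-space. HOL cannot
  quantify over the types carrying these test spaces inside a formula, so the type is a parameter.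
  A theorem concluding \<open>G_fibration TYPE('x) \<dots>\<close> with \<open>'x\<close> a type variable covers test spaces on
  all types. A hypothesis uses a particular instance and is thereby at most weaker than the
  unrestricted property; the instance \<open>TYPE('e \<times> (real \<Rightarrow> 'b))\<close> contains the mapping path space
  \<open>{(e, \<gamma>). \<gamma> 0 = p e}\<close>.
\<close>

definition G_fibration ::
  "'x itself \<Rightarrow> ('g, 'm) monoid_scheme \<Rightarrow> 'g topology \<Rightarrow>
   ('g, 'e) gspace \<Rightarrow> ('g, 'b) gspace \<Rightarrow> ('e \<Rightarrow> 'b) \<Rightarrow> bool" where
  "G_fibration TYPE('x) G T E B p \<longleftrightarrow>
     G_space G T E \<and> G_space G T B \<and> G_map G E B p \<and>
     (\<forall>X :: ('g, 'x) gspace. G_space G T X \<longrightarrow> G_HLP G X E B p)"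

definition G_secat ::
  "('g, 'm) monoid_scheme \<Rightarrow> ('g, 'e) gspace \<Rightarrow> ('g, 'b) gspace \<Rightarrow> ('e \<Rightarrow> 'b) \<Rightarrow> enat" where
  "G_secat G E B p =
     Inf {enat k |k. k \<ge> 1 \<and>
       (\<exists>U :: nat \<Rightarrow> 'b set. (\<Union>i\<in>{1..k}. U i) = pts B \<and>
         (\<forall>i\<in>{1..k}. openin (gtop B) (U i) \<and> G_invariant G B (U i) \<and>
           (\<exists>s. G_map G (gsubspace B (U i)) E s \<and>
                G_homotopic G (gsubspace B (U i)) B (p \<circ> s) (\<lambda>x. x))))}"

text \<open>The non-equivariant notions are those of the one-element group acting trivially.\<close>

definition trivial_gspace :: "'x topology \<Rightarrow> (unit, 'x) gspace" where
  "trivial_gspace X = \<lparr>gtop = X, gact = (\<lambda>_. restrict id (topspace X))\<rparr>"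

definition fibration :: "'x itself \<Rightarrow> 'e topology \<Rightarrow> 'b topology \<Rightarrow> ('e \<Rightarrow> 'b) \<Rightarrow> bool" where
  "fibration TYPE('x) E B p \<longleftrightarrow>
     G_fibration TYPE('x) (singleton_group ()) (discrete_topology {()})
       (trivial_gspace E) (trivial_gspace B) p"

definition secat :: "'e topology \<Rightarrow> 'b topology \<Rightarrow> ('e \<Rightarrow> 'b) \<Rightarrow> enat" where
  "secat E B p = G_secat (singleton_group ()) (trivial_gspace E) (trivial_gspace B) p"

end

theory Submission
  imports Defs
begin

text \<open>
  A lift of a homotopy can be chosen so canonically that every symmetry of the data is a symmetry
  of the lift, and this single remark yields all the fibration statements. The space of pairs
  \<open>(e, \<gamma>)\<close>, where \<open>\<gamma>\<close> is a path in \<open>B\<close> starting at \<open>p e\<close>, carries the action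
  \<open>g (e, \<gamma>) = (g e, g \<gamma>)\<close>, and with the compact-open topology on paths it is a \<open>G\<close>-space
  (\<open>G_space_mapping_path_gspace\<close>). Lifting the tautological homotopy \<open>(t, (e, \<gamma>)) \<mapsto> \<gamma> t\<close> on it gives
  an equivariant map \<open>\<Lambda>\<close> that turns \<open>(e, \<gamma>)\<close> into a path over \<open>\<gamma>\<close> starting at \<open>e\<close>
  (\<open>equivariant_path_lifting\<close>). For an arbitrary space \<open>X\<close>, with or without an action, a homotopy
  \<open>F\<close> of \<open>p \<circ> f\<close> is lifted by \<open>F' (t, x) = \<Lambda> (t, (f x, F (\<cdot>, x)))\<close>. Whenever an element \<open>g\<close> of \<open>G\<close>
  carries the data \<open>(f x, F (\<cdot>, x))\<close> to the data at \<open>y\<close>, it carries the lift at \<open>x\<close> to the lift at \<open>y\<close>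
  (\<open>G_fibration_natural_lift\<close>).

  The two uses of this naturality are \<open>y = k x\<close>, which makes \<open>F'\<close> equivariant for any group acting
  through \<open>G\<close>, and \<open>y = x\<close>, which keeps \<open>F'\<close> inside the \<open>H\<close>-fixed points when \<open>f\<close> and \<open>F\<close> are
  there. So \<open>p\<close> restricts to a fibration between \<open>H\<close>-fixed points for each group acting through \<open>G\<close>
  (\<open>G_fibration_fixed_part\<close>).

  The inequalities rest on the same principle for equivariant maps: they send \<open>H\<close>-fixed points to
  \<open>H\<close>-fixed points. Hence a cover of \<open>B\<close> by invariant open sets with homotopy sections restricts
  to such a cover of the fixed points of \<open>B\<close>, with the same number of members
  (\<open>G_secat_fixed_part_le\<close>). The fixed points of the empty set are the whole space, and the
  one-element group acts through the unit of \<open>G\<close>, so the cases of a subgroup, of fixed points, and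
  of no action at all are instances of the same two lemmas.
\<close>

section \<open>Group actions\<close>

lemma group_action_intro:
  assumes G: "group G"
    and ext: "\<And>g. g \<in> carrier G \<Longrightarrow> \<phi> g \<in> extensional S"
    and closed: "\<And>g x. g \<in> carrier G \<Longrightarrow> x \<in> S \<Longrightarrow> \<phi> g x \<in> S"
    and one: "\<And>x. x \<in> S \<Longrightarrow> \<phi> \<one>\<^bsub>G\<^esub> x = x"
    and mult: "\<And>g h x. g \<in> carrier G \<Longrightarrow> h \<in> carrier G \<Longrightarrow> x \<in> S \<Longrightarrow>
      \<phi> (g \<otimes>\<^bsub>G\<^esub> h) x = \<phi> g (\<phi> h x)"
  shows "group_action G S \<phi>"
proof -
  interpret group G by (rule G)
  have Bij: "\<phi> g \<in> Bij S" if g: "g \<in> carrier G" for g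
  proof -
    have "\<phi> (inv\<^bsub>G\<^esub> g) (\<phi> g x) = x" "\<phi> g (\<phi> (inv\<^bsub>G\<^esub> g) x) = x" if "x \<in> S" for x
      using that g one mult[of "inv\<^bsub>G\<^esub> g" g x] mult[of g "inv\<^bsub>G\<^esub> g" x] by simp_all
    then have "bij_betw (\<phi> g) S S"
      using g closed by (intro bij_betw_byWitness[where f' = "\<phi> (inv\<^bsub>G\<^esub> g)"]) auto
    then show ?thesis
      using ext[OF g] by (simp add: Bij_def)
  qed
  have "\<phi> (g \<otimes>\<^bsub>G\<^esub> h) = compose S (\<phi> g) (\<phi> h)" if "g \<in> carrier G" "h \<in> carrier G" for g h
    using that ext mult by (intro extensionalityI[where A = S]) (auto simp: compose_eq)
  then have "\<phi> \<in> hom G (BijGroup S)"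
    using Bij by (auto simp: hom_def BijGroup_def)
  then show ?thesis
    using G by (simp add: group_action_def group_hom_def group_hom_axioms_def group_BijGroup)
qed

lemma group_action_group: "group_action G S \<phi> \<Longrightarrow> group G"
  by (simp add: group_action_def group_hom_def)

lemma G_space_act_closed:
  "G_space G T X \<Longrightarrow> g \<in> carrier G \<Longrightarrow> x \<in> pts X \<Longrightarrow> gact X g x \<in> pts X"
  unfolding G_space_def by (blast intro: group_action.element_image)

lemma G_space_act_one: "G_space G T X \<Longrightarrow> x \<in> pts X \<Longrightarrow> gact X \<one>\<^bsub>G\<^esub> x = x"
  unfolding G_space_def by (metis group_action.id_eq_one restrict_apply')

lemma G_space_act_mult:
  "G_space G T X \<Longrightarrow> g \<in> carrier G \<Longrightarrow> h \<in> carrier G \<Longrightarrow> x \<in> pts X \<Longrightarrow>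
    gact X (g \<otimes>\<^bsub>G\<^esub> h) x = gact X g (gact X h x)"
  unfolding G_space_def by (blast intro: group_action.composition_rule)

lemma G_space_act_extensional:
  "G_space G T X \<Longrightarrow> g \<in> carrier G \<Longrightarrow> gact X g \<in> extensional (pts X)"
  unfolding G_space_def by (blast intro: group_action.bij_prop0 Bij_imp_extensional)

lemma continuous_map_act:
  "G_space G T X \<Longrightarrow>
    continuous_map (prod_topology T (gtop X)) (gtop X) (\<lambda>z. gact X (fst z) (snd z))"
  by (simp add: G_space_def case_prod_beta')

lemma G_space_subgroup:
  assumes X: "G_space G T X" and K: "subgroup K G"
  shows "G_space (G\<lparr>carrier := K\<rparr>) (subtopology T K) X"
proof -
  have G: "group G"
    using X by (auto simp: G_space_def intro: group_action_group)
  have KG: "k \<in> carrier G" if "k \<in> K" for k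
    using K that by (rule subgroup.mem_carrier)
  have "group_action (G\<lparr>carrier := K\<rparr>) (pts X) (gact X)"
    using KG X subgroup.subgroup_is_group[OF K G]
    by (intro group_action_intro)
      (auto simp: G_space_act_closed G_space_act_one G_space_act_mult G_space_act_extensional)
  moreover have "continuous_map (prod_topology (subtopology T K) (gtop X)) (gtop X)
      (\<lambda>(g, x). gact X g x)"
    using X by (simp add: G_space_def prod_topology_subtopology(1) continuous_map_from_subtopology)
  ultimately show ?thesis
    using X by (simp add: G_space_def)
qed

lemma G_space_trivial_gspace:
  assumes "Hausdorff_space X"
  shows "G_space (singleton_group ()) (discrete_topology {()}) (trivial_gspace X)"
proof -
  have "group_action (singleton_group ()) (topspace X) (\<lambda>_. restrict id (topspace X))"
    by (rule group_action_intro) auto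
  moreover have "continuous_map (prod_topology (discrete_topology {()}) X) X
      (\<lambda>(g, x). restrict id (topspace X) x)"
    by (rule continuous_map_eq[OF continuous_map_snd]) auto
  ultimately show ?thesis
    using assms by (simp add: G_space_def trivial_gspace_def)
qed

section \<open>The compact-open topology on the space of paths\<close>

lemma continuous_map_comp:
  "continuous_map X Y f \<Longrightarrow> continuous_map Y Z g \<Longrightarrow> continuous_map X Z (\<lambda>x. g (f x))"
  using continuous_map_compose[of X Y f Z g] by (simp add: o_def)

lemma continuous_map_comp_snd:
  "continuous_map Y Z g \<Longrightarrow> continuous_map (prod_topology X Y) Z (\<lambda>z. g (snd z))"
  by (rule continuous_map_comp[OF continuous_map_snd])

text \<open>
  Paths are extensional outside \<open>[0,1]\<close>: otherwise different functions could be the same path, the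
  path space would not be Hausdorff, and the unit of \<open>G\<close> would not act on it as the identity.
\<close>

definition paths_in :: "'b topology \<Rightarrow> (real \<Rightarrow> 'b) set" where
  "paths_in B = {\<gamma> \<in> extensional {0..1}. continuous_map (top_of_set {0..1}) B \<gamma>}"

definition path_space :: "'b topology \<Rightarrow> (real \<Rightarrow> 'b) topology" where
  "path_space B = topology_generated_by
     {{\<gamma> \<in> paths_in B. \<gamma> ` C \<subseteq> U} |C U. closedin (top_of_set {0..1}) C \<and> openin B U}"

lemma topspace_path_space [simp]: "topspace (path_space B) = paths_in B"
proof -
  \<comment> \<open>The basic set of the empty compact set is the whole path space.\<close>
  have "paths_in B = {\<gamma> \<in> paths_in B. \<gamma> ` {} \<subseteq> topspace B}"
    by auto
  then have "paths_in B \<in>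
      {{\<gamma> \<in> paths_in B. \<gamma> ` C \<subseteq> U} |C U. closedin (top_of_set {0..1}) C \<and> openin B U}"
    using closedin_empty openin_topspace by blast
  then show ?thesis
    unfolding path_space_def topology_generated_by_topspace by auto
qed

lemma openin_path_space_basic:
  "closedin (top_of_set {0..1}) C \<Longrightarrow> openin B U \<Longrightarrow>
    openin (path_space B) {\<gamma> \<in> paths_in B. \<gamma> ` C \<subseteq> U}"
  unfolding path_space_def by (rule topology_generated_by_Basis) blast

lemma paths_in_apply: "\<gamma> \<in> paths_in B \<Longrightarrow> t \<in> {0..1} \<Longrightarrow> \<gamma> t \<in> topspace B"
  by (auto simp: paths_in_def continuous_map_def)

text \<open>
  This is where local compactness of \<open>[0,1]\<close> enters: a path that is in \<open>U\<close> at time \<open>t\<close> stays in \<open>U\<close>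
  on a compact neighbourhood of \<open>t\<close>, and doing so is an open condition on paths.
\<close>

lemma continuous_map_path_eval:
  "continuous_map (prod_topology (top_of_set {0..1}) (path_space B)) B (\<lambda>(t, \<gamma>). \<gamma> t)"
    (is "continuous_map ?X B ?ev")
proof -
  have "openin ?X {z \<in> topspace ?X. ?ev z \<in> U}" if U: "openin B U" for U
  proof (subst openin_subopen, safe)
    fix t \<gamma> assume z: "(t, \<gamma>) \<in> topspace ?X" "\<gamma> t \<in> U"
    then have t: "t \<in> {0..1}" and \<gamma>: "\<gamma> \<in> paths_in B"
      by auto
    then have "openin (top_of_set {0..1}) {s \<in> {0..1}. \<gamma> s \<in> U}"
      using U openin_continuous_map_preimage[of "top_of_set {0..1}" B \<gamma> U]
      by (simp add: paths_in_def)
    then obtain e where "e > 0" and e: "cball t e \<inter> {0..1} \<subseteq> {s \<in> {0..1}. \<gamma> s \<in> U}"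
      using t z(2) by (auto simp: openin_contains_cball)
    define C where "C = cball t e \<inter> {0..1}"
    let ?W = "(ball t e \<inter> {0..1}) \<times> {\<delta> \<in> paths_in B. \<delta> ` C \<subseteq> U}"
    have "closedin (top_of_set {0..1}) C"
      unfolding C_def by (metis closed_cball closedin_closed_Int inf_commute)
    moreover have "openin (top_of_set {0..1}) (ball t e \<inter> {0..1})"
      by (metis inf_commute open_ball openin_open_Int)
    ultimately have "openin ?X ?W"
      using U by (simp add: openin_prod_Times_iff openin_path_space_basic)
    moreover have "(t, \<gamma>) \<in> ?W"
      using t \<gamma> e \<open>e > 0\<close> by (auto simp: C_def)
    moreover have "?W \<subseteq> {z \<in> topspace ?X. ?ev z \<in> U}"
      by (auto simp: C_def less_imp_le)
    ultimately show "\<exists>W. openin ?X W \<and> (t, \<gamma>) \<in> W \<and> W \<subseteq> {z \<in> topspace ?X. ?ev z \<in> U}"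
      by blast
  qed
  then show ?thesis
    by (auto simp: continuous_map_def paths_in_apply)
qed

lemma mem_snd_image: "x \<in> snd ` Z \<longleftrightarrow> (\<exists>t. (t, x) \<in> Z)"
  by force

text \<open>
  The points \<open>x\<close> whose path leaves \<open>U\<close> somewhere on \<open>C\<close> form the projection to \<open>X\<close> of a closed subset
  of \<open>[0,1] \<times> X\<close>. They form a closed set, since projecting along the compact interval is a closed map.
\<close>

lemma continuous_map_path_curry:
  assumes F: "continuous_map (prod_topology (top_of_set {0..1}) X) B F"
  shows "continuous_map X (path_space B) (\<lambda>x. restrict (\<lambda>t. F (t, x)) {0..1})" (is "continuous_map X _ ?c")
proof -
  let ?I = "top_of_set {0..1::real}"
  have path: "?c x \<in> paths_in B" if "x \<in> topspace X" for x
  proof -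
    have "continuous_map ?I (prod_topology ?I X) (\<lambda>t. (t, x))"
      using that by (simp add: continuous_map_pairedI)
    then have "continuous_map ?I B (F \<circ> (\<lambda>t. (t, x)))"
      using F by (rule continuous_map_compose)
    then have "continuous_map ?I B (?c x)"
      by (rule continuous_map_eq) auto
    then show ?thesis
      by (simp add: paths_in_def)
  qed
  have "openin X (?c -` {\<gamma> \<in> paths_in B. \<gamma> ` C \<subseteq> U} \<inter> topspace X)"
    if C: "closedin ?I C" and U: "openin B U" for C U
  proof -
    let ?Z = "{z \<in> topspace (prod_topology ?I X). F z \<in> topspace B - U} \<inter> (C \<times> topspace X)"
    have "closedin (prod_topology ?I X) ?Z"
      using closedin_continuous_map_preimage[OF F, of "topspace B - U"] C U
      by (intro closedin_Int) (auto simp: closedin_prod_Times_iff)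
    moreover have "closed_map (prod_topology ?I X) X snd"
      by (rule Abstract_Topological_Spaces.closed_map_snd) (simp add: compact_space_subtopology)
    ultimately have "closedin X (snd ` ?Z)"
      by (simp add: closed_map_def)
    moreover have "?c -` {\<gamma> \<in> paths_in B. \<gamma> ` C \<subseteq> U} \<inter> topspace X = topspace X - snd ` ?Z"
    proof -
      have CI: "C \<subseteq> {0..1}"
        using C closedin_subset by fastforce
      have FB: "F (t, x) \<in> topspace B" if "t \<in> {0..1}" "x \<in> topspace X" for t x
        using paths_in_apply[OF path[OF that(2)] that(1)] that(1) by simp
      show ?thesis
      proof (rule Set.set_eqI)
        fix x
        show "x \<in> ?c -` {\<gamma> \<in> paths_in B. \<gamma> ` C \<subseteq> U} \<inter> topspace X \<longleftrightarrow> x \<in> topspace X - snd ` ?Z"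
        proof (cases "x \<in> topspace X")
          case True
          have "(t, x) \<in> ?Z \<longleftrightarrow> t \<in> C \<and> F (t, x) \<notin> U" for t
            using True CI FB[of t x] by auto
          then have "x \<in> snd ` ?Z \<longleftrightarrow> (\<exists>t\<in>C. F (t, x) \<notin> U)"
            by (simp only: mem_snd_image) blast
          moreover have "?c x ` C \<subseteq> U \<longleftrightarrow> (\<forall>t\<in>C. F (t, x) \<in> U)"
            unfolding image_subset_iff using CI by (metis (no_types, lifting) restrict_apply' subsetD)
          ultimately show ?thesis
            using True path[OF True] by simp
        qed simp
      qed
    qed
    ultimately show ?thesis
      by (simp add: openin_diff)
  qed
  then show ?thesis
    using path topspace_path_space[of B]
    unfolding path_space_def continuous_on_generated_topo_iff topology_generated_by_topspace
    by blast
qed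

text \<open>
  Two different paths differ at some \<open>t\<close>, and the sets of paths passing at \<open>t\<close> through
  disjoint open sets separate them.
\<close>

lemma Hausdorff_space_path_space:
  assumes "Hausdorff_space B"
  shows "Hausdorff_space (path_space B)"
  unfolding Hausdorff_space_def
proof safe
  fix \<gamma> \<delta> assume \<gamma>: "\<gamma> \<in> topspace (path_space B)" and \<delta>: "\<delta> \<in> topspace (path_space B)" and "\<gamma> \<noteq> \<delta>"
  then obtain t where t: "t \<in> {0..1}" and ne: "\<gamma> t \<noteq> \<delta> t"
    unfolding topspace_path_space paths_in_def by (metis (mono_tags, lifting) extensionalityI mem_Collect_eq)
  then obtain U V where UV: "openin B U" "openin B V" "\<gamma> t \<in> U" "\<delta> t \<in> V" "disjnt U V"
    using assms \<gamma> \<delta> paths_in_apply unfolding Hausdorff_space_def topspace_path_space by metis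
  have "closedin (top_of_set {0..1}) {t}"
    using t by (simp add: closedin_closed_eq)
  then have "openin (path_space B) {\<epsilon> \<in> paths_in B. \<epsilon> ` {t} \<subseteq> U}"
    and "openin (path_space B) {\<epsilon> \<in> paths_in B. \<epsilon> ` {t} \<subseteq> V}"
    using UV by (blast intro: openin_path_space_basic)+
  moreover have "disjnt {\<epsilon> \<in> paths_in B. \<epsilon> ` {t} \<subseteq> U} {\<epsilon> \<in> paths_in B. \<epsilon> ` {t} \<subseteq> V}"
    using UV(5) by (auto simp: disjnt_def)
  ultimately show "\<exists>U V. openin (path_space B) U \<and> openin (path_space B) V \<and> \<gamma> \<in> U \<and> \<delta> \<in> V \<and> disjnt U V"
    using \<gamma> \<delta> UV(3,4) by (intro exI[of _ "{\<epsilon> \<in> paths_in B. \<epsilon> ` {t} \<subseteq> U}"] exI[of _ "{\<epsilon> \<in> paths_in B. \<epsilon> ` {t} \<subseteq> V}"]) auto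
qed

section \<open>The equivariant path lifting function\<close>

definition mapping_paths :: "('g, 'e) gspace \<Rightarrow> ('g, 'b) gspace \<Rightarrow> ('e \<Rightarrow> 'b) \<Rightarrow> ('e \<times> (real \<Rightarrow> 'b)) set" where
  "mapping_paths E B p = {(e, \<gamma>). e \<in> pts E \<and> \<gamma> \<in> paths_in (gtop B) \<and> \<gamma> 0 = p e}"

definition path_act :: "('g, 'b) gspace \<Rightarrow> 'g \<Rightarrow> (real \<Rightarrow> 'b) \<Rightarrow> real \<Rightarrow> 'b" where
  "path_act B g \<gamma> = restrict (\<lambda>t. gact B g (\<gamma> t)) {0..1}"

text \<open>
  The mapping path space of \<open>p\<close>: maps from \<open>X\<close> into it are exactly the homotopy lifting problems
  on \<open>X\<close>.
\<close>

definition mapping_path_gspace ::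
  "('g, 'e) gspace \<Rightarrow> ('g, 'b) gspace \<Rightarrow> ('e \<Rightarrow> 'b) \<Rightarrow> ('g, 'e \<times> (real \<Rightarrow> 'b)) gspace" where
  "mapping_path_gspace E B p =
     \<lparr>gtop = subtopology (prod_topology (gtop E) (path_space (gtop B))) (mapping_paths E B p),
      gact = (\<lambda>g. restrict (\<lambda>(e, \<gamma>). (gact E g e, path_act B g \<gamma>)) (mapping_paths E B p))\<rparr>"

lemma pts_mapping_path_gspace [simp]: "pts (mapping_path_gspace E B p) = mapping_paths E B p"
  by (auto simp: mapping_path_gspace_def mapping_paths_def)

lemma gact_mapping_path_gspace:
  "(e, \<gamma>) \<in> mapping_paths E B p \<Longrightarrow>
    gact (mapping_path_gspace E B p) g (e, \<gamma>) = (gact E g e, path_act B g \<gamma>)"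
  by (simp add: mapping_path_gspace_def)

text \<open>
  By currying, joint continuity of the action on paths reduces to continuity of
  \<open>(t, g, \<gamma>) \<mapsto> g \<cdot> \<gamma> t\<close>, a composite of evaluation and the action on \<open>B\<close>.
\<close>

lemma continuous_map_path_act:
  assumes B: "G_space G T B"
  shows "continuous_map (prod_topology T (path_space (gtop B))) (path_space (gtop B))
    (\<lambda>(g, \<gamma>). path_act B g \<gamma>)"
proof -
  let ?I = "top_of_set {0..1::real}" and ?P = "path_space (gtop B)"
  let ?X = "prod_topology ?I (prod_topology T ?P)"
  have g: "continuous_map ?X T (\<lambda>z. fst (snd z))"
    by (intro continuous_map_comp_snd continuous_map_fst)
  have \<gamma>: "continuous_map ?X ?P (\<lambda>z. snd (snd z))"
    by (intro continuous_map_comp_snd continuous_map_snd)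
  have "continuous_map ?X (prod_topology ?I ?P) (\<lambda>z. (fst z, snd (snd z)))"
    using \<gamma> by (simp add: continuous_map_pairedI continuous_map_fst)
  from continuous_map_comp[OF this continuous_map_path_eval]
  have "continuous_map ?X (gtop B) (\<lambda>z. snd (snd z) (fst z))"
    by simp
  with g have "continuous_map ?X (prod_topology T (gtop B)) (\<lambda>z. (fst (snd z), snd (snd z) (fst z)))"
    by (simp add: continuous_map_pairedI)
  from continuous_map_comp[OF this continuous_map_act[OF B]]
  have "continuous_map ?X (gtop B) (\<lambda>z. gact B (fst (snd z)) (snd (snd z) (fst z)))"
    by simp
  from continuous_map_path_curry[OF this] show ?thesis
    by (simp add: path_act_def case_prod_beta')
qed

lemma path_act_in_paths:
  assumes B: "G_space G T B" and T: "topspace T = carrier G"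
    and "g \<in> carrier G" "\<gamma> \<in> paths_in (gtop B)"
  shows "path_act B g \<gamma> \<in> paths_in (gtop B)"
proof -
  have "(g, \<gamma>) \<in> topspace (prod_topology T (path_space (gtop B)))"
    using assms(2-4) by simp
  with continuous_map_path_act[OF B] show ?thesis
    by (metis (no_types, lifting) PiE case_prod_conv continuous_map_def topspace_path_space)
qed

text \<open>
  The action stays among the pairs with \<open>\<gamma> 0 = p e\<close> because \<open>p\<close> is equivariant.
\<close>

lemma G_space_mapping_path_gspace:
  assumes T: "topspace T = carrier G" and E: "G_space G T E" and B: "G_space G T B"
    and p: "G_map G E B p"
  shows "G_space G T (mapping_path_gspace E B p)"
proof -
  let ?M = "mapping_paths E B p" and ?X = "mapping_path_gspace E B p"
  let ?Q = "prod_topology (gtop E) (path_space (gtop B))"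
  have G: "group G"
    using E by (auto simp: G_space_def intro: group_action_group)
  interpret group G by (rule G)
  have closed: "(gact E g e, path_act B g \<gamma>) \<in> ?M" if "g \<in> carrier G" "(e, \<gamma>) \<in> ?M" for g e \<gamma>
    using that p path_act_in_paths[OF B T] G_space_act_closed[OF E]
    by (auto simp: mapping_paths_def path_act_def G_map_def equivariant_def)
  have one: "path_act B \<one>\<^bsub>G\<^esub> \<gamma> = \<gamma>" if "\<gamma> \<in> paths_in (gtop B)" for \<gamma>
    using that paths_in_apply[OF that] G_space_act_one[OF B]
    by (intro extensionalityI[where A = "{0..1}"]) (auto simp: path_act_def paths_in_def)
  have mult: "path_act B (g \<otimes>\<^bsub>G\<^esub> h) \<gamma> = path_act B g (path_act B h \<gamma>)"
    if "g \<in> carrier G" "h \<in> carrier G" "\<gamma> \<in> paths_in (gtop B)" for g h \<gamma>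
    using that paths_in_apply[OF that(3)] G_space_act_mult[OF B]
    by (intro extensionalityI[where A = "{0..1}"]) (auto simp: path_act_def)
  have "group_action G ?M (gact ?X)"
  proof (rule group_action_intro[OF G])
    fix g assume "g \<in> carrier G"
    show "gact ?X g \<in> extensional ?M"
      by (simp add: mapping_path_gspace_def)
  next
    fix g z assume "g \<in> carrier G" "z \<in> ?M"
    then show "gact ?X g z \<in> ?M"
      by (cases z) (simp add: gact_mapping_path_gspace closed)
  next
    fix z assume "z \<in> ?M"
    then show "gact ?X \<one>\<^bsub>G\<^esub> z = z"
      by (cases z)
        (auto simp: gact_mapping_path_gspace G_space_act_one[OF E] one mapping_paths_def)
  next
    fix g h z assume gh: "g \<in> carrier G" "h \<in> carrier G" and z: "z \<in> ?M"
    obtain e \<gamma> where [simp]: "z = (e, \<gamma>)"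
      by (cases z)
    have "e \<in> pts E" "\<gamma> \<in> paths_in (gtop B)"
      using z by (auto simp: mapping_paths_def)
    then show "gact ?X (g \<otimes>\<^bsub>G\<^esub> h) z = gact ?X g (gact ?X h z)"
      using gh z closed[of h e \<gamma>] by (simp add: gact_mapping_path_gspace G_space_act_mult[OF E] mult)
  qed
  moreover have "continuous_map (prod_topology T (gtop ?X)) (gtop ?X) (\<lambda>(g, z). gact ?X g z)"
  proof -
    let ?S = "subtopology (prod_topology T ?Q) (topspace T \<times> ?M)"
    let ?f = "\<lambda>z. (gact E (fst z) (fst (snd z)), path_act B (fst z) (snd (snd z)))"
    have eq: "prod_topology T (gtop ?X) = ?S"
      by (simp add: mapping_path_gspace_def prod_topology_subtopology(2))
    have "continuous_map (prod_topology T ?Q) (gtop E) (\<lambda>z. fst (snd z))"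
      "continuous_map (prod_topology T ?Q) (path_space (gtop B)) (\<lambda>z. snd (snd z))"
      by (intro continuous_map_comp_snd continuous_map_fst continuous_map_snd)+
    then have "continuous_map (prod_topology T ?Q) (prod_topology T (gtop E)) (\<lambda>z. (fst z, fst (snd z)))"
      and "continuous_map (prod_topology T ?Q) (prod_topology T (path_space (gtop B)))
        (\<lambda>z. (fst z, snd (snd z)))"
      by (auto intro: continuous_map_pairedI continuous_map_fst)
    from continuous_map_comp[OF this(1) continuous_map_act[OF E]]
      continuous_map_comp[OF this(2) continuous_map_path_act[OF B]]
    have "continuous_map (prod_topology T ?Q) (gtop E) (\<lambda>z. gact E (fst z) (fst (snd z)))"
      and "continuous_map (prod_topology T ?Q) (path_space (gtop B)) (\<lambda>z. path_act B (fst z) (snd (snd z)))"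
      by simp_all
    then have "continuous_map (prod_topology T ?Q) ?Q ?f"
      by (rule continuous_map_pairedI)
    then have "continuous_map ?S (gtop ?X) ?f"
      using T closed
      by (auto simp: mapping_path_gspace_def continuous_map_in_subtopology continuous_map_from_subtopology)
    then have "continuous_map ?S (gtop ?X) (\<lambda>(g, z). gact ?X g z)"
      by (rule continuous_map_eq) (auto simp: gact_mapping_path_gspace)
    then show ?thesis
      by (simp only: eq)
  qed
  moreover have "Hausdorff_space (gtop ?X)"
    using E B by (simp add: mapping_path_gspace_def G_space_def Hausdorff_space_subtopology
        Hausdorff_space_prod_topology Hausdorff_space_path_space)
  ultimately show ?thesis
    by (simp add: G_space_def)
qed

text \<open>
  The tautological homotopy on the mapping path space is the universal lifting problem; applying the
  fibration property to this one test space solves all others.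
\<close>

lemma equivariant_path_lifting:
  fixes E :: "('g, 'e) gspace" and B :: "('g, 'b) gspace"
  assumes T: "topspace T = carrier G"
    and fib: "G_fibration TYPE('e \<times> (real \<Rightarrow> 'b)) G T E B p"
  obtains \<Lambda> where "G_homotopy G (mapping_path_gspace E B p) E \<Lambda>"
    and "\<And>e \<gamma>. (e, \<gamma>) \<in> mapping_paths E B p \<Longrightarrow> \<Lambda> (0, (e, \<gamma>)) = e"
    and "\<And>t e \<gamma>. t \<in> {0..1} \<Longrightarrow> (e, \<gamma>) \<in> mapping_paths E B p \<Longrightarrow> p (\<Lambda> (t, (e, \<gamma>))) = \<gamma> t"
proof -
  let ?X = "mapping_path_gspace E B p"
  let ?Q = "prod_topology (gtop E) (path_space (gtop B))"
  have E: "G_space G T E" and B: "G_space G T B" and p: "G_map G E B p"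
    and HLP: "G_HLP G X E B p" if "G_space G T X" for X :: "('g, 'e \<times> (real \<Rightarrow> 'b)) gspace"
    using fib that by (auto simp: G_fibration_def)
  have X: "G_space G T ?X"
    using T fib by (simp add: G_fibration_def G_space_mapping_path_gspace)
  have "G_map G ?X E fst"
    unfolding G_map_def equivariant_def
    by (auto simp: gact_mapping_path_gspace mapping_path_gspace_def
        intro: continuous_map_from_subtopology continuous_map_fst)
  moreover have "G_homotopy G ?X B (\<lambda>(t, (e, \<gamma>)). \<gamma> t)"
  proof -
    have "continuous_map (prod_topology (top_of_set {0..1}) (gtop ?X))
        (prod_topology (top_of_set {0..1}) (path_space (gtop B))) (\<lambda>z. (fst z, snd (snd z)))"
    proof (intro continuous_map_pairedI continuous_map_fst)
      have "continuous_map (gtop ?X) (path_space (gtop B)) snd"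
        by (simp add: mapping_path_gspace_def continuous_map_from_subtopology continuous_map_snd)
      then show "continuous_map (prod_topology (top_of_set {0..1}) (gtop ?X)) (path_space (gtop B))
          (\<lambda>z. snd (snd z))"
        by (rule continuous_map_comp_snd)
    qed
    from continuous_map_comp[OF this continuous_map_path_eval]
    have "continuous_map (prod_topology (top_of_set {0..1}) (gtop ?X)) (gtop B) (\<lambda>(t, (e, \<gamma>)). \<gamma> t)"
      by (simp add: case_prod_beta')
    then show ?thesis
      by (auto simp: G_homotopy_def equivariant_def gact_mapping_path_gspace path_act_def)
  qed
  moreover have "\<forall>x\<in>pts ?X. (\<lambda>(t, (e, \<gamma>)). \<gamma> t) (0, x) = p (fst x)"
    by (auto simp: mapping_paths_def)
  ultimately obtain \<Lambda> where "G_homotopy G ?X E \<Lambda>" "\<forall>x\<in>pts ?X. \<Lambda> (0, x) = fst x"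
    "\<forall>t\<in>{0..1}. \<forall>x\<in>pts ?X. p (\<Lambda> (t, x)) = (\<lambda>(t, (e, \<gamma>)). \<gamma> t) (t, x)"
    using HLP[OF X] unfolding G_HLP_def by blast
  then show ?thesis
    by (intro that[of \<Lambda>]) auto
qed

text \<open>
  The lift is the pullback of the universal one along \<open>x \<mapsto> (f x, F (\<cdot>, x))\<close>. There is no action on \<open>X\<close>;
  the last property expresses instead that the lift at a point is an equivariant function of the
  data at that point, which serves both to make lifts equivariant and to keep them in fixed-point
  sets.
\<close>

lemma G_fibration_natural_lift:
  fixes E :: "('g, 'e) gspace" and B :: "('g, 'b) gspace" and X :: "'x topology"
    and F :: "real \<times> 'x \<Rightarrow> 'b"
  assumes T: "topspace T = carrier G"
    and fib: "G_fibration TYPE('e \<times> (real \<Rightarrow> 'b)) G T E B p"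
    and f: "continuous_map X (gtop E) f"
    and F: "continuous_map (prod_topology (top_of_set {0..1}) X) (gtop B) F"
    and F0: "\<And>x. x \<in> topspace X \<Longrightarrow> F (0, x) = p (f x)"
  obtains F' where "continuous_map (prod_topology (top_of_set {0..1}) X) (gtop E) F'"
    and "\<And>x. x \<in> topspace X \<Longrightarrow> F' (0, x) = f x"
    and "\<And>t x. t \<in> {0..1} \<Longrightarrow> x \<in> topspace X \<Longrightarrow> p (F' (t, x)) = F (t, x)"
    and "\<And>g x y t. g \<in> carrier G \<Longrightarrow> x \<in> topspace X \<Longrightarrow> f y = gact E g (f x) \<Longrightarrow>
      (\<And>s. s \<in> {0..1} \<Longrightarrow> F (s, y) = gact B g (F (s, x))) \<Longrightarrow> t \<in> {0..1} \<Longrightarrow>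
      F' (t, y) = gact E g (F' (t, x))"
proof -
  obtain \<Lambda> where \<Lambda>: "G_homotopy G (mapping_path_gspace E B p) E \<Lambda>"
    and \<Lambda>0: "\<And>e \<gamma>. (e, \<gamma>) \<in> mapping_paths E B p \<Longrightarrow> \<Lambda> (0, (e, \<gamma>)) = e"
    and p\<Lambda>: "\<And>t e \<gamma>. t \<in> {0..1} \<Longrightarrow> (e, \<gamma>) \<in> mapping_paths E B p \<Longrightarrow> p (\<Lambda> (t, (e, \<gamma>))) = \<gamma> t"
    using equivariant_path_lifting[OF T fib] by blast
  let ?I = "top_of_set {0..1::real}" and ?M = "gtop (mapping_path_gspace E B p)"
  define m where "m x = (f x, restrict (\<lambda>t. F (t, x)) {0..1})" for x
  have path: "continuous_map X (path_space (gtop B)) (\<lambda>x. restrict (\<lambda>t. F (t, x)) {0..1})"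
    using F by (rule continuous_map_path_curry)
  then have m: "m x \<in> mapping_paths E B p" if "x \<in> topspace X" for x
    using that f F0 by (auto simp: m_def mapping_paths_def continuous_map_def)
  have "continuous_map X (prod_topology (gtop E) (path_space (gtop B))) m"
    unfolding m_def using f path by (rule continuous_map_pairedI)
  then have "continuous_map X ?M m"
    using m by (auto simp: mapping_path_gspace_def continuous_map_in_subtopology)
  then have "continuous_map (prod_topology ?I X) ?M (\<lambda>z. m (snd z))"
    by (rule continuous_map_comp_snd)
  then have "continuous_map (prod_topology ?I X) (prod_topology ?I ?M) (\<lambda>z. (fst z, m (snd z)))"
    by (simp add: continuous_map_pairedI continuous_map_fst)
  moreover have "continuous_map (prod_topology ?I ?M) (gtop E) \<Lambda>"
    using \<Lambda> by (simp add: G_homotopy_def)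
  ultimately have cont: "continuous_map (prod_topology ?I X) (gtop E) (\<lambda>z. \<Lambda> (fst z, m (snd z)))"
    by (rule continuous_map_comp)
  have natural: "\<Lambda> (t, m y) = gact E g (\<Lambda> (t, m x))"
    if g: "g \<in> carrier G" and x: "x \<in> topspace X" and "f y = gact E g (f x)"
      and "\<And>s. s \<in> {0..1} \<Longrightarrow> F (s, y) = gact B g (F (s, x))" and t: "t \<in> {0..1}" for g x y t
  proof -
    have "m y = gact (mapping_path_gspace E B p) g (m x)"
      using that m[OF x] by (auto simp: m_def gact_mapping_path_gspace path_act_def restrict_def)
    then show ?thesis
      using \<Lambda> g t m[OF x] by (simp add: G_homotopy_def equivariant_def)
  qed
  show ?thesis
  proof (rule that[of "\<lambda>z. \<Lambda> (fst z, m (snd z))"])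
    show "\<Lambda> (fst (0, x), m (snd (0, x))) = f x" if "x \<in> topspace X" for x
      using \<Lambda>0 m[OF that] by (simp add: m_def)
    show "p (\<Lambda> (fst (t, x), m (snd (t, x)))) = F (t, x)" if "t \<in> {0..1}" "x \<in> topspace X" for t x
      using p\<Lambda>[OF that(1)] m[OF that(2)] that(1) by (simp add: m_def)
  qed (use cont natural in auto)
qed

section \<open>Passing to fixed points and restricting the acting group\<close>

text \<open>
  The \<open>H\<close>-fixed points of \<open>X\<close> with a group \<open>L\<close> acting through \<open>\<phi>\<close>. The group \<open>L\<close> may have elements of
  another type, so that the one-element group is covered along with the subgroups of \<open>G\<close>, and \<open>H = {}\<close>
  gives the whole space with the acting group changed. The equation on actions is required at fixed
  points only, since actions on a subspace are cut down to it.
\<close>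

definition fixed_part_along ::
  "('l, 'n) monoid_scheme \<Rightarrow> ('l \<Rightarrow> 'g) \<Rightarrow> 'g set \<Rightarrow> ('g, 'x) gspace \<Rightarrow> ('l, 'x) gspace \<Rightarrow> bool" where
  "fixed_part_along L \<phi> H X X' \<longleftrightarrow>
     gtop X' = subtopology (gtop X) (fixed_points X H) \<and>
     (\<forall>l\<in>carrier L. \<forall>x\<in>fixed_points X H.
        gact X' l x = gact X (\<phi> l) x \<and> gact X' l x \<in> fixed_points X H)"

lemma pts_fixed_part_along:
  "fixed_part_along L \<phi> H X X' \<Longrightarrow> pts X' = fixed_points X H"
  by (auto simp: fixed_part_along_def fixed_points_def)

text \<open>
  Naturality of the lift with \<open>g = h \<in> H\<close> and \<open>y = x\<close> shows that \<open>h\<close> fixes the lift; with \<open>g = \<phi> l\<close>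
  and \<open>y = l x\<close> it shows that the lift is \<open>L\<close>-equivariant.
\<close>

lemma G_fibration_fixed_part:
  fixes E :: "('g, 'e) gspace" and B :: "('g, 'b) gspace"
    and L :: "('l, 'n) monoid_scheme" and \<phi> :: "'l \<Rightarrow> 'g"
  assumes T: "topspace T = carrier G"
    and fib: "G_fibration TYPE('e \<times> (real \<Rightarrow> 'b)) G T E B p"
    and H: "H \<subseteq> carrier G" and \<phi>: "\<phi> ` carrier L \<subseteq> carrier G"
    and E': "G_space L S E'" "fixed_part_along L \<phi> H E E'"
    and B': "G_space L S B'" "fixed_part_along L \<phi> H B B'"
  shows "G_fibration TYPE('x) L S E' B' p"
proof -
  have gE': "gtop E' = subtopology (gtop E) (fixed_points E H)"
    and aE: "\<And>l e. l \<in> carrier L \<Longrightarrow> e \<in> fixed_points E H \<Longrightarrow> gact E' l e = gact E (\<phi> l) e"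
    using E'(2) by (auto simp: fixed_part_along_def)
  have gB': "gtop B' = subtopology (gtop B) (fixed_points B H)"
    and aB: "\<And>l b. l \<in> carrier L \<Longrightarrow> b \<in> fixed_points B H \<Longrightarrow> gact B' l b = gact B (\<phi> l) b"
    using B'(2) by (auto simp: fixed_part_along_def)
  note ptsE = pts_fixed_part_along[OF E'(2)] and ptsB = pts_fixed_part_along[OF B'(2)]
  have pc: "continuous_map (gtop E) (gtop B) p"
    and pe: "\<And>g e. g \<in> carrier G \<Longrightarrow> e \<in> pts E \<Longrightarrow> p (gact E g e) = gact B g (p e)"
    using fib by (auto simp: G_fibration_def G_map_def equivariant_def)
  have pfix: "p e \<in> fixed_points B H" if "e \<in> fixed_points E H" for e
  proof -
    have "gact B h (p e) = p e" if "h \<in> H" for h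
      using pe[of h e] H that \<open>e \<in> fixed_points E H\<close> by (auto simp: fixed_points_def)
    then show ?thesis
      using that pc by (auto simp: fixed_points_def continuous_map_def)
  qed
  have "G_map L E' B' p"
    unfolding G_map_def equivariant_def
  proof (intro conjI ballI)
    show "continuous_map (gtop E') (gtop B') p"
      using pc pfix ptsE by (auto simp: gE' gB' continuous_map_in_subtopology continuous_map_from_subtopology)
    fix l e assume "l \<in> carrier L" "e \<in> pts E'"
    then show "p (gact E' l e) = gact B' l (p e)"
      using aE aB pfix pe[of "\<phi> l" e] \<phi> ptsE by (auto simp: fixed_points_def)
  qed
  moreover have "G_HLP L X E' B' p" if X: "G_space L S X" for X :: "('l, 'x) gspace"
    unfolding G_HLP_def
  proof (intro allI impI, elim conjE)
    fix f F
    assume f: "G_map L X E' f" and F: "G_homotopy L X B' F" and F0: "\<forall>x\<in>pts X. F (0, x) = p (f x)"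
    have fc: "continuous_map (gtop X) (gtop E) f"
      and ffix: "\<And>x. x \<in> pts X \<Longrightarrow> f x \<in> fixed_points E H"
      using f ptsE by (auto simp: G_map_def gE' continuous_map_in_subtopology)
    have Fc: "continuous_map (prod_topology (top_of_set {0..1}) (gtop X)) (gtop B) F"
      and Ffix: "\<And>t x. t \<in> {0..1} \<Longrightarrow> x \<in> pts X \<Longrightarrow> F (t, x) \<in> fixed_points B H"
      using F ptsB by (auto simp: G_homotopy_def gB' continuous_map_in_subtopology)
    have F0': "\<And>x. x \<in> pts X \<Longrightarrow> F (0, x) = p (f x)"
      using F0 by blast
    obtain F' where F'c: "continuous_map (prod_topology (top_of_set {0..1}) (gtop X)) (gtop E) F'"
      and F'0: "\<And>x. x \<in> pts X \<Longrightarrow> F' (0, x) = f x"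
      and pF': "\<And>t x. t \<in> {0..1} \<Longrightarrow> x \<in> pts X \<Longrightarrow> p (F' (t, x)) = F (t, x)"
      and natural: "\<And>g x y t. g \<in> carrier G \<Longrightarrow> x \<in> pts X \<Longrightarrow> f y = gact E g (f x) \<Longrightarrow>
        (\<And>s. s \<in> {0..1} \<Longrightarrow> F (s, y) = gact B g (F (s, x))) \<Longrightarrow> t \<in> {0..1} \<Longrightarrow>
        F' (t, y) = gact E g (F' (t, x))"
      using G_fibration_natural_lift[OF T fib fc Fc F0'] by blast
    have F'fix: "F' (t, x) \<in> fixed_points E H" if t: "t \<in> {0..1}" and x: "x \<in> pts X" for t x
    proof -
      have "gact E h (F' (t, x)) = F' (t, x)" if h: "h \<in> H" for h
        using natural[of h x x t] ffix[OF x] Ffix[OF _ x] H h t x by (auto simp: fixed_points_def)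
      then show ?thesis
        using F'c t x by (auto simp: fixed_points_def continuous_map_def)
    qed
    have "F' (t, gact X l x) = gact E' l (F' (t, x))"
      if l: "l \<in> carrier L" and t: "t \<in> {0..1}" and x: "x \<in> pts X" for l t x
    proof -
      have "f (gact X l x) = gact E (\<phi> l) (f x)"
        using f l x aE ffix by (auto simp: G_map_def equivariant_def)
      moreover have "F (s, gact X l x) = gact B (\<phi> l) (F (s, x))" if "s \<in> {0..1}" for s
        using F l x that aB Ffix by (auto simp: G_homotopy_def equivariant_def)
      ultimately have "F' (t, gact X l x) = gact E (\<phi> l) (F' (t, x))"
        using natural \<phi> l x t by blast
      then show ?thesis
        using aE[OF l F'fix[OF t x]] by simp
    qed
    then have "G_homotopy L X E' F'"
      using F'c F'fix by (auto simp: G_homotopy_def equivariant_def gE' continuous_map_in_subtopology)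
    then show "\<exists>F'. G_homotopy L X E' F' \<and> (\<forall>x\<in>pts X. F' (0, x) = f x) \<and>
        (\<forall>t\<in>{0..1}. \<forall>x\<in>pts X. p (F' (t, x)) = F (t, x))"
      using F'0 pF' by blast
  qed
  ultimately show ?thesis
    using E'(1) B'(1) by (simp add: G_fibration_def)
qed

text \<open>
  The section and the homotopy are kept as they are and only viewed on the smaller domain. Their
  values at \<open>H\<close>-fixed points are \<open>H\<close>-fixed by equivariance, so they land in the smaller targets.
\<close>

lemma homotopy_section_fixed_part:
  fixes E :: "('g, 'e) gspace" and B :: "('g, 'b) gspace"
  assumes H: "H \<subseteq> carrier G" and \<phi>: "\<phi> ` carrier L \<subseteq> carrier G"
    and E': "fixed_part_along L \<phi> H E E'" and B': "fixed_part_along L \<phi> H B B'"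
    and U: "G_invariant G B U"
    and s: "G_map G (gsubspace B U) E s"
    and ps: "G_homotopic G (gsubspace B U) B (p \<circ> s) (\<lambda>x. x)"
  defines "U' \<equiv> U \<inter> fixed_points B H"
  shows "G_map L (gsubspace B' U') E' s"
    and "G_homotopic L (gsubspace B' U') B' (p \<circ> s) (\<lambda>x. x)"
proof -
  have gE': "gtop E' = subtopology (gtop E) (fixed_points E H)"
    and aE: "\<And>l e. l \<in> carrier L \<Longrightarrow> e \<in> fixed_points E H \<Longrightarrow> gact E' l e = gact E (\<phi> l) e"
    using E' by (auto simp: fixed_part_along_def)
  have gB': "gtop B' = subtopology (gtop B) (fixed_points B H)"
    and aB: "\<And>l b. l \<in> carrier L \<Longrightarrow> b \<in> fixed_points B H \<Longrightarrow> gact B' l b = gact B (\<phi> l) b"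
    using B' by (auto simp: fixed_part_along_def)
  have topU': "gtop (gsubspace B' U') = subtopology (gtop (gsubspace B U)) U'"
    by (simp add: gsubspace_def gB' U'_def subtopology_subtopology Int_ac)
  have ptsU': "pts (gsubspace B' U') = U'" and ptsU: "pts (gsubspace B U) = pts B \<inter> U"
    by (auto simp: gsubspace_def gB' U'_def fixed_points_def)
  have U'D: "x \<in> pts B" "x \<in> U" "x \<in> fixed_points B H" if "x \<in> U'" for x
    using that by (auto simp: U'_def fixed_points_def)
  have act_fix: "gact (gsubspace B U) h x = x" if "h \<in> H" "x \<in> U'" for h x
    using that by (auto simp: gsubspace_def U'_def fixed_points_def)
  have act_L: "gact (gsubspace B' U') l x = gact (gsubspace B U) (\<phi> l) x"
    if "l \<in> carrier L" "x \<in> U'" for l x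
    using that aB by (auto simp: gsubspace_def U'_def)

  \<comment> \<open>The next two facts are needed for \<open>s\<close> and for each stage of the homotopy, hence for any target \<open>Y\<close>.\<close>
  have fixed: "f x \<in> fixed_points Y H"
    if f: "equivariant G (gsubspace B U) Y f" and x: "x \<in> U'" and "f x \<in> pts Y"
    for f :: "'b \<Rightarrow> 'y" and Y x
  proof -
    have "gact Y h (f x) = f x" if "h \<in> H" for h
      using f that act_fix[OF that x] H U'D[OF x] ptsU unfolding equivariant_def by (metis IntI subsetD)
    then show ?thesis
      using that by (simp add: fixed_points_def)
  qed
  have equiv: "equivariant L (gsubspace B' U') Y' f"
    if f: "equivariant G (gsubspace B U) Y f" and Y': "fixed_part_along L \<phi> H Y Y'"
      and pts: "\<And>x. x \<in> U' \<Longrightarrow> f x \<in> pts Y"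
    for f :: "'b \<Rightarrow> 'y" and Y Y'
    unfolding equivariant_def ptsU'
  proof (intro ballI)
    fix l x assume l: "l \<in> carrier L" and x: "x \<in> U'"
    have "f (gact (gsubspace B' U') l x) = gact Y (\<phi> l) (f x)"
      using f l x \<phi> U'D[OF x] ptsU act_L by (auto simp: equivariant_def)
    also have "\<dots> = gact Y' l (f x)"
      using fixed[OF f x pts[OF x]] l Y' by (simp add: fixed_part_along_def)
    finally show "f (gact (gsubspace B' U') l x) = gact Y' l (f x)" .
  qed

  have s_pts: "s x \<in> pts E" if "x \<in> U'" for x
    using s U'D[OF that] ptsU by (auto simp: G_map_def continuous_map_def)
  have "continuous_map (gtop (gsubspace B' U')) (gtop E') s"
    using s s_pts fixed[of E s] ptsU'
    by (auto simp: G_map_def topU' gE' continuous_map_in_subtopology continuous_map_from_subtopology)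
  moreover have "equivariant L (gsubspace B' U') E' s"
    using s s_pts equiv[OF _ E'] by (simp add: G_map_def)
  ultimately show "G_map L (gsubspace B' U') E' s"
    by (simp add: G_map_def)

  obtain h where hc: "continuous_map (prod_topology (top_of_set {0..1::real}) (gtop (gsubspace B U))) (gtop B) h"
    and h0: "\<And>x. h (0, x) = (p \<circ> s) x" and h1: "\<And>x. h (1, x) = x"
    and he: "\<And>t. t \<in> {0..1} \<Longrightarrow> equivariant G (gsubspace B U) B (\<lambda>x. h (t, x))"
    using ps unfolding G_homotopic_def homotopic_with_def by blast
  have h_pts: "h (t, x) \<in> pts B" if "t \<in> {0..1}" "x \<in> U'" for t x
    using hc that U'D[OF that(2)] ptsU by (auto simp: continuous_map_def)
  have "continuous_map (prod_topology (top_of_set {0..1}) (gtop (gsubspace B' U'))) (gtop B') h"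
    using hc ptsU' fixed[OF he] h_pts
    by (auto simp: topU' gB' continuous_map_in_subtopology prod_topology_subtopology(2)
        continuous_map_from_subtopology)
  moreover have "equivariant L (gsubspace B' U') B' (\<lambda>x. h (t, x))" if "t \<in> {0..1}" for t
    using equiv[OF he[OF that] B'] h_pts[OF that] by simp
  ultimately show "G_homotopic L (gsubspace B' U') B' (p \<circ> s) (\<lambda>x. x)"
    using h0 h1 by (auto simp: G_homotopic_def homotopic_with_def)
qed

text \<open>
  Every number of sets that suffices for \<open>B\<close> suffices for its fixed points, as each set of the cover
  can be intersected with them. Thus the infimum on the left is taken over a larger set.
\<close>

lemma G_secat_fixed_part_le:
  assumes H: "H \<subseteq> carrier G" and \<phi>: "\<phi> ` carrier L \<subseteq> carrier G"
    and E': "fixed_part_along L \<phi> H E E'" and B': "fixed_part_along L \<phi> H B B'"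
  shows "G_secat L E' B' p \<le> G_secat G E B p"
  unfolding G_secat_def
proof (rule Inf_superset_mono, safe)
  fix k :: nat and U
  assume k: "1 \<le> k" and cover: "(\<Union>i\<in>{1..k}. U i) = pts B"
    and U: "\<forall>i\<in>{1..k}. openin (gtop B) (U i) \<and> G_invariant G B (U i) \<and>
      (\<exists>s. G_map G (gsubspace B (U i)) E s \<and> G_homotopic G (gsubspace B (U i)) B (p \<circ> s) (\<lambda>x. x))"
  define U' where "U' i = U i \<inter> fixed_points B H" for i
  have "(\<Union>i\<in>{1..k}. U' i) = pts B'"
    using cover pts_fixed_part_along[OF B'] by (auto simp: U'_def fixed_points_def)
  moreover have "openin (gtop B') (U' i) \<and> G_invariant L B' (U' i) \<and>
      (\<exists>s. G_map L (gsubspace B' (U' i)) E' s \<and> G_homotopic L (gsubspace B' (U' i)) B' (p \<circ> s) (\<lambda>x. x))"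
    if i: "i \<in> {1..k}" for i
  proof (intro conjI)
    show "openin (gtop B') (U' i)"
      using U i B' by (auto simp: fixed_part_along_def U'_def openin_subtopology)
    show "G_invariant L B' (U' i)"
      using U i B' \<phi> unfolding G_invariant_def U'_def fixed_part_along_def by fastforce
    show "\<exists>s. G_map L (gsubspace B' (U' i)) E' s \<and> G_homotopic L (gsubspace B' (U' i)) B' (p \<circ> s) (\<lambda>x. x)"
      using homotopy_section_fixed_part[OF H \<phi> E' B', of "U i"] U i unfolding U'_def by blast
  qed
  ultimately show "\<exists>k'. enat k = enat k' \<and> 1 \<le> k' \<and>
      (\<exists>U. (\<Union>i\<in>{1..k'}. U i) = pts B' \<and>
        (\<forall>i\<in>{1..k'}. openin (gtop B') (U i) \<and> G_invariant L B' (U i) \<and>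
          (\<exists>s. G_map L (gsubspace B' (U i)) E' s \<and>
            G_homotopic L (gsubspace B' (U i)) B' (p \<circ> s) (\<lambda>x. x))))"
    using k by blast
qed

lemma fixed_points_empty [simp]: "fixed_points X {} = pts X"
  by (simp add: fixed_points_def)

lemma fixed_part_along_subgroup:
  assumes "G_space G T X" "subgroup K G"
  shows "fixed_part_along (G\<lparr>carrier := K\<rparr>) id {} X X"
  using assms by (auto simp: fixed_part_along_def intro: G_space_act_closed subgroup.mem_carrier)

lemma fixed_part_along_fixed_space:
  assumes "G_invariant (G\<lparr>carrier := K\<rparr>) X (fixed_points X H)"
  shows "fixed_part_along (G\<lparr>carrier := K\<rparr>) id H X (fixed_space X H)"
  using assms by (auto simp: fixed_part_along_def fixed_space_def gsubspace_def G_invariant_def)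

lemma fixed_part_along_trivial_gspace:
  assumes "G_space G T X"
  shows "fixed_part_along (singleton_group ()) (\<lambda>_. \<one>\<^bsub>G\<^esub>) H X
    (trivial_gspace (subtopology (gtop X) (fixed_points X H)))"
  using assms by (auto simp: fixed_part_along_def trivial_gspace_def fixed_points_def G_space_act_one)

theorem proposition2p12:
  fixes G :: "('g, 'm) monoid_scheme" and T :: "'g topology"
    and E :: "('g, 'e) gspace" and B :: "('g, 'b) gspace" and p :: "'e \<Rightarrow> 'b"
  assumes "topological_group G T"
    and "G_fibration TYPE('e \<times> (real \<Rightarrow> 'b)) G T E B p"
  shows "(\<forall>H K. subgroup H G \<and> subgroup K G \<and>
            G_invariant (G\<lparr>carrier := K\<rparr>) E (fixed_points E H) \<and>
            G_invariant (G\<lparr>carrier := K\<rparr>) B (fixed_points B H) \<and>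
            G_map (G\<lparr>carrier := K\<rparr>) (fixed_space E H) (fixed_space B H) p \<longrightarrow>
            G_secat (G\<lparr>carrier := K\<rparr>) (fixed_space E H) (fixed_space B H) p \<le> G_secat G E B p)
       \<and> (compact_space T \<and> Hausdorff_space T \<longrightarrow>
            (\<forall>H. subgroup H G \<and> closedin T H \<longrightarrow>
               fibration TYPE('x) (gtop (fixed_space E H)) (gtop (fixed_space B H)) p \<and>
               secat (gtop (fixed_space E H)) (gtop (fixed_space B H)) p \<le> G_secat G E B p)
          \<and> (\<forall>K. subgroup K G \<and> closedin T K \<longrightarrow>
               G_fibration TYPE('x) (G\<lparr>carrier := K\<rparr>) (subtopology T K) E B p \<and>
               secat (gtop E) (gtop B) p \<le> G_secat (G\<lparr>carrier := K\<rparr>) E B p \<and>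
               G_secat (G\<lparr>carrier := K\<rparr>) E B p \<le> G_secat G E B p))"
proof -
  have T: "topspace T = carrier G" and G: "group G"
    using assms(1) by (auto simp: topological_group_def topological_group_axioms_def)
  interpret group G by (rule G)
  have E: "G_space G T E" and B: "G_space G T B"
    using assms(2) by (auto simp: G_fibration_def)
  have fixed_K: "G_secat (G\<lparr>carrier := K\<rparr>) (fixed_space E H) (fixed_space B H) p \<le> G_secat G E B p"
    if "subgroup H G" "subgroup K G"
      "G_invariant (G\<lparr>carrier := K\<rparr>) E (fixed_points E H)"
      "G_invariant (G\<lparr>carrier := K\<rparr>) B (fixed_points B H)" for H K
    using that by (intro G_secat_fixed_part_le[where H = H and \<phi> = id])
      (auto simp: subgroup.mem_carrier fixed_part_along_fixed_space)
  have gtop_fixed: "gtop (fixed_space X H) = subtopology (gtop X) (fixed_points X H)"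
    for X :: "('g, 'y) gspace" and H
    by (simp add: fixed_space_def gsubspace_def)
  have fixed_nonequiv: "fibration TYPE('x) (gtop (fixed_space E H)) (gtop (fixed_space B H)) p"
    "secat (gtop (fixed_space E H)) (gtop (fixed_space B H)) p \<le> G_secat G E B p"
    if H: "subgroup H G" for H
  proof -
    have \<phi>: "(\<lambda>_. \<one>\<^bsub>G\<^esub>) ` carrier (singleton_group ()) \<subseteq> carrier G" and HG: "H \<subseteq> carrier G"
      using H by (auto simp: subgroup.mem_carrier)
    have haus: "Hausdorff_space (gtop (fixed_space E H))" "Hausdorff_space (gtop (fixed_space B H))"
      using E B by (auto simp: gtop_fixed G_space_def Hausdorff_space_subtopology)
    show "fibration TYPE('x) (gtop (fixed_space E H)) (gtop (fixed_space B H)) p"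
      unfolding fibration_def
      using haus fixed_part_along_trivial_gspace[OF E, of H] fixed_part_along_trivial_gspace[OF B, of H]
      by (intro G_fibration_fixed_part[OF T assms(2) HG \<phi>] G_space_trivial_gspace)
        (simp_all add: gtop_fixed)
    show "secat (gtop (fixed_space E H)) (gtop (fixed_space B H)) p \<le> G_secat G E B p"
      unfolding secat_def gtop_fixed
      by (intro G_secat_fixed_part_le[OF HG \<phi>] fixed_part_along_trivial_gspace[OF E]
          fixed_part_along_trivial_gspace[OF B])
  qed
  have sub: "G_fibration TYPE('x) (G\<lparr>carrier := K\<rparr>) (subtopology T K) E B p"
    "secat (gtop E) (gtop B) p \<le> G_secat (G\<lparr>carrier := K\<rparr>) E B p"
    "G_secat (G\<lparr>carrier := K\<rparr>) E B p \<le> G_secat G E B p"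
    if K: "subgroup K G" for K
  proof -
    have \<phi>: "id ` carrier (G\<lparr>carrier := K\<rparr>) \<subseteq> carrier G"
      using K by (auto simp: subgroup.mem_carrier)
    note EK = G_space_subgroup[OF E K] and BK = G_space_subgroup[OF B K]
    note parts = fixed_part_along_subgroup[OF E K] fixed_part_along_subgroup[OF B K]
    show "G_fibration TYPE('x) (G\<lparr>carrier := K\<rparr>) (subtopology T K) E B p"
      using G_fibration_fixed_part[OF T assms(2) empty_subsetI \<phi> EK parts(1) BK parts(2)] .
    show "G_secat (G\<lparr>carrier := K\<rparr>) E B p \<le> G_secat G E B p"
      using G_secat_fixed_part_le[OF empty_subsetI \<phi> parts] .
    have "\<one>\<^bsub>G\<^esub> \<in> K"
      using K by (rule subgroup.one_closed)
    then show "secat (gtop E) (gtop B) p \<le> G_secat (G\<lparr>carrier := K\<rparr>) E B p"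
      unfolding secat_def
      \<comment> \<open>The fixed points of the empty set make up the whole space.\<close>
      using fixed_part_along_trivial_gspace[OF EK, of "{}"] fixed_part_along_trivial_gspace[OF BK, of "{}"]
      by (intro G_secat_fixed_part_le[where H = "{}" and \<phi> = "\<lambda>_. \<one>\<^bsub>G\<^esub>"]) (auto simp: subtopology_topspace)
  qed
  show ?thesis
    using fixed_K fixed_nonequiv sub by blast
qed

end
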